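(* Let $\Omega=(a,b)\subset\mathbb{R}$ be a bounded interval, let $G$ and $H$ be Young functions satisfying the $\Delta'$ condition with constant $C$, and let $w\in L^\infty(\Omega)$ be a non-negative weight function which is not a.e. zero. Assume further that $H\prec G$ with constant $k>0$, i.e. $H(t)\le G(kt)$ for all $t\ge0$. For $\mu>0$ let $\lambda_{1,\mu}$ be the first eigenvalue at energy level $\mu$ of $$-\left(g(|u'|)\frac{u'}{|u'|}\right)'=\lambda\, w(x)\,h(|u|)\frac{u}{|u|}\ \text{ in }(a,b),\qquad u(a)=u(b)=0,$$ where $g=G'$, $h=H'$. Then $$\frac{b-a}{C\,k\,\|w\|_{L^1(\Omega)}\,G\left(\frac{k(b-a)}{2}\right)}\le\lambda_{1,\mu}\qquad\text{for any }\mu>0.$$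
   Context: Young functions. A Young function is a map $G:[0,\infty)\to[0,\infty)$ of the form $G(t)=\int_0^t g(s)\,ds$ with $g=G'$ right-continuous on $[0,\infty)$, $g(0)=0$, $g(t)>0$ for $t>0$, $g$ nondecreasing, and $\lim_{t\to\infty}g(t)=\infty$. The Young functions $G,H$ are normalized by $G(1)=H(1)=1$, have absolutely continuous derivatives, and satisfy, for constants $1\le p^-\le p^+<\infty$, $p^-\le \frac{tG'(t)}{G(t)}\le p^+$ for all $t>0$ (same for $H$). $\Delta'$ condition with constant $C\ge1$: $G(xy)\le C\,G(x)G(y)$ for all $x,y\ge0$ (and the same for $H$). Spaces. $\|u\|_G=\inf\{\delta>0:\int_\Omega G(|u|/\delta)\,dx\le1\}$; $L^G(\Omega)$ is the set of measurable $u$ with $\int_\Omega G(|u|)\,dx<\infty$; $W^{1,G}(\Omega)=\{u\in L^G(\Omega):u'\in L^G(\Omega)\}$ and $W^{1,G}_0(\Omega)$ is the closure of $C_c^\infty(\Omega)$ in $W^{1,G}(\Omega)$ for the norm $\|u\|_G+\|u'\|_G$. First eigenvalue. For $\mu>0$ let $\mathcal{A}_\mu=\{u\in W_0^{1,G}(\Omega):\int_\Omega wH(|u|)\,dx=\mu\}$ and $$\lambda_{1,\mu}=\inf\left\{\frac{\int_\Omega G(|u'|)\,dx}{\int_\Omega wH(|u|)\,dx}: u\in\mathcal{A}_\mu\right\}.$$ *)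

theory Defs
  imports "HOL-Analysis.Analysis"
begin

section \<open>Young functions\<close>

text \<open>
  A map on \<open>[0,\<infinity>)\<close> is represented by a function on \<open>real\<close>, about whose values at negative
  arguments nothing is assumed.
\<close>

definition young_function :: "(real \<Rightarrow> real) \<Rightarrow> (real \<Rightarrow> real) \<Rightarrow> bool" where
  "young_function G g \<longleftrightarrow>
     (\<forall>t\<ge>0. (g has_integral G t) {0..t}) \<and>
     (\<forall>t\<ge>0. continuous (at_right t) g) \<and>
     g 0 = 0 \<and> (\<forall>t>0. 0 < g t) \<and> mono_on {0..} g \<and> filterlim g at_top at_top"

definition abs_cont_on_interval :: "real \<Rightarrow> real \<Rightarrow> (real \<Rightarrow> real) \<Rightarrow> bool" where
  "abs_cont_on_interval s t f \<longleftrightarrow>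
     (\<forall>\<epsilon>>0. \<exists>\<delta>>0. \<forall>(n::nat) x y.
        (\<forall>i<n. s \<le> x i \<and> x i \<le> y i \<and> y i \<le> t) \<and>
        disjoint_family_on (\<lambda>i. {x i<..<y i}) {..<n} \<and>
        (\<Sum>i<n. y i - x i) < \<delta> \<longrightarrow>
        (\<Sum>i<n. \<bar>f (y i) - f (x i)\<bar>) < \<epsilon>)"

text \<open>
  The standing assumptions on a Young function. Absolute continuity of \<open>g = G'\<close> on the unbounded
  interval \<open>[0,\<infinity>)\<close> is understood on its compact subintervals: powers \<open>t powr (p - 1)\<close> with
  \<open>p > 2\<close> are not uniformly continuous on all of \<open>[0,\<infinity>)\<close>.
\<close>

definition standard_young_function ::
    "real \<Rightarrow> real \<Rightarrow> (real \<Rightarrow> real) \<Rightarrow> (real \<Rightarrow> real) \<Rightarrow> bool" where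
  "standard_young_function p1 p2 G g \<longleftrightarrow>
     young_function G g \<and> G 1 = 1 \<and> (\<forall>T>0. abs_cont_on_interval 0 T g) \<and>
     (\<forall>t>0. p1 \<le> t * g t / G t \<and> t * g t / G t \<le> p2)"

definition Delta'_condition :: "real \<Rightarrow> (real \<Rightarrow> real) \<Rightarrow> bool" where
  "Delta'_condition C G \<longleftrightarrow> 1 \<le> C \<and> (\<forall>x\<ge>0. \<forall>y\<ge>0. G (x * y) \<le> C * G x * G y)"

definition dominated_with :: "real \<Rightarrow> (real \<Rightarrow> real) \<Rightarrow> (real \<Rightarrow> real) \<Rightarrow> bool" where
  "dominated_with k H G \<longleftrightarrow> 0 < k \<and> (\<forall>t\<ge>0. H t \<le> G (k * t))"

section \<open>Orlicz and Orlicz--Sobolev spaces on an open set of reals\<close>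

text \<open>
  Elements of the function spaces are represented by functions on \<open>real\<close>; only their
  a.e. behaviour on \<open>\<Omega>\<close> matters.
\<close>

definition L_infty :: "real set \<Rightarrow> (real \<Rightarrow> real) set" where
  "L_infty \<Omega> = {w \<in> borel_measurable (lebesgue_on \<Omega>). \<exists>M. AE x in lebesgue_on \<Omega>. \<bar>w x\<bar> \<le> M}"

definition Orlicz :: "(real \<Rightarrow> real) \<Rightarrow> real set \<Rightarrow> (real \<Rightarrow> real) set" where
  "Orlicz G \<Omega> = {u \<in> borel_measurable (lebesgue_on \<Omega>).
                  integrable (lebesgue_on \<Omega>) (\<lambda>x. G \<bar>u x\<bar>)}"

definition luxemburg_norm :: "(real \<Rightarrow> real) \<Rightarrow> real set \<Rightarrow> (real \<Rightarrow> real) \<Rightarrow> real" where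
  "luxemburg_norm G \<Omega> u =
     Inf {\<delta>. \<delta> > 0 \<and> (\<integral>\<^sup>+x. ennreal (G (\<bar>u x\<bar> / \<delta>)) \<partial>lebesgue_on \<Omega>) \<le> 1}"

text \<open>The space \<open>C\<^sub>c\<^sup>\<infinity>(\<Omega>)\<close>, its elements being extended by zero outside \<open>\<Omega>\<close>.\<close>

definition test_functions :: "real set \<Rightarrow> (real \<Rightarrow> real) set" where
  "test_functions \<Omega> = {\<phi>. (\<forall>n x. (deriv ^^ n) \<phi> differentiable (at x)) \<and>
                          (\<exists>K. compact K \<and> K \<subseteq> \<Omega> \<and> (\<forall>x. x \<notin> K \<longrightarrow> \<phi> x = 0))}"

definition locally_integrable :: "real set \<Rightarrow> (real \<Rightarrow> real) \<Rightarrow> bool" where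
  "locally_integrable \<Omega> u \<longleftrightarrow> (\<forall>K. compact K \<and> K \<subseteq> \<Omega> \<longrightarrow> u absolutely_integrable_on K)"

definition has_weak_deriv :: "real set \<Rightarrow> (real \<Rightarrow> real) \<Rightarrow> (real \<Rightarrow> real) \<Rightarrow> bool" where
  "has_weak_deriv \<Omega> u v \<longleftrightarrow> locally_integrable \<Omega> u \<and> locally_integrable \<Omega> v \<and>
     (\<forall>\<phi>\<in>test_functions \<Omega>.
        (LINT x|lebesgue_on \<Omega>. u x * deriv \<phi> x) = - (LINT x|lebesgue_on \<Omega>. v x * \<phi> x))"

text \<open>Weak derivatives are unique up to a.e. equality; the choice fixes a representative.\<close>

definition weak_deriv :: "real set \<Rightarrow> (real \<Rightarrow> real) \<Rightarrow> real \<Rightarrow> real" where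
  "weak_deriv \<Omega> u = (SOME v. has_weak_deriv \<Omega> u v)"

definition W1 :: "(real \<Rightarrow> real) \<Rightarrow> real set \<Rightarrow> (real \<Rightarrow> real) set" where
  "W1 G \<Omega> = {u \<in> Orlicz G \<Omega>. (\<exists>v. has_weak_deriv \<Omega> u v) \<and> weak_deriv \<Omega> u \<in> Orlicz G \<Omega>}"

text \<open>
  The closure of \<open>C\<^sub>c\<^sup>\<infinity>(\<Omega>)\<close> in \<open>W1 G \<Omega>\<close>: the weak derivative of \<open>u - \<phi>\<close> is a.e. the weak
  derivative of \<open>u\<close> minus the classical derivative of the test function \<open>\<phi>\<close>.
\<close>

definition W1_0 :: "(real \<Rightarrow> real) \<Rightarrow> real set \<Rightarrow> (real \<Rightarrow> real) set" where
  "W1_0 G \<Omega> = {u \<in> W1 G \<Omega>. \<forall>\<epsilon>>0. \<exists>\<phi>\<in>test_functions \<Omega>.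
     luxemburg_norm G \<Omega> (\<lambda>x. u x - \<phi> x) +
     luxemburg_norm G \<Omega> (\<lambda>x. weak_deriv \<Omega> u x - deriv \<phi> x) < \<epsilon>}"

section \<open>The first eigenvalue at a given energy level\<close>

definition admissible ::
    "(real \<Rightarrow> real) \<Rightarrow> (real \<Rightarrow> real) \<Rightarrow> (real \<Rightarrow> real) \<Rightarrow> real set \<Rightarrow> real \<Rightarrow> (real \<Rightarrow> real) set" where
  "admissible G H w \<Omega> \<mu> = {u \<in> W1_0 G \<Omega>.
     integrable (lebesgue_on \<Omega>) (\<lambda>x. w x * H \<bar>u x\<bar>) \<and>
     (LINT x|lebesgue_on \<Omega>. w x * H \<bar>u x\<bar>) = \<mu>}"

text \<open>
  The infimum is taken in the extended reals, so that no convention on the infimum of an empty set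
  of reals enters.
\<close>

definition first_eigenvalue ::
    "(real \<Rightarrow> real) \<Rightarrow> (real \<Rightarrow> real) \<Rightarrow> (real \<Rightarrow> real) \<Rightarrow> real set \<Rightarrow> real \<Rightarrow> ereal" where
  "first_eigenvalue G H w \<Omega> \<mu> =
     (INF u \<in> admissible G H w \<Omega> \<mu>.
        ereal ((LINT x|lebesgue_on \<Omega>. G \<bar>weak_deriv \<Omega> u x\<bar>) /
               (LINT x|lebesgue_on \<Omega>. w x * H \<bar>u x\<bar>)))"

end

theory Submission
  imports Defs
begin

text \<open>
  A function \<open>u\<close> with weak derivative \<open>v\<close> in the closure of the test functions inherits from them
  the bound \<open>2\<bar>u(x)\<bar> \<le> \<integral>\<bar>v\<bar>\<close> for a.e. \<open>x\<close>, since convergence in the Luxemburg norm implies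
  convergence in \<open>L\<^sup>1\<close>. Hence \<open>H(\<bar>u\<bar>) \<le> G(k\<bar>u\<bar>) \<le> G((k(b - a)/2) m)\<close>, where \<open>m\<close> is the mean of
  \<open>\<bar>v\<bar>\<close>; the \<open>\<Delta>'\<close> condition splits off \<open>C G(k(b - a)/2)\<close>, and Jensen's inequality bounds the
  remaining \<open>G(m)\<close> by the mean of \<open>G(\<bar>v\<bar>)\<close>. Integrating against \<open>w\<close> gives the estimate even
  without the factor \<open>k\<close>, which is harmless as the normalization \<open>G(1) = H(1) = 1\<close> forces \<open>k \<ge> 1\<close>.
\<close>

section \<open>Young functions\<close>

lemma young_function_zero:
  assumes "young_function G g" shows "G 0 = 0"
proof -
  have "(g has_integral G 0) {0..0}"
    using assms unfolding young_function_def by blast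
  then show ?thesis
    using has_integral_refl(2)[of g 0] has_integral_unique[of g "G 0" "{0..0}" 0] by simp
qed

lemma young_function_nonneg_deriv:
  assumes "young_function G g" "0 \<le> t" shows "0 \<le> g t"
  using assms unfolding young_function_def by (cases "t = 0") (auto simp: less_imp_le)

lemma young_function_has_integral:
  assumes "young_function G g" "0 \<le> s" "s \<le> t"
  shows "(g has_integral (G t - G s)) {s..t}"
proof -
  have s: "(g has_integral G s) {0..s}" and t: "(g has_integral G t) {0..t}"
    using assms unfolding young_function_def by auto
  have "g integrable_on {s..t}"
    using t assms(2,3) integrable_on_subinterval[of g "{0..t}" s t] by auto
  then obtain i where i: "(g has_integral i) {s..t}" by blast
  have "(g has_integral G s + i) {0..t}"
    using has_integral_combine[OF assms(2,3) s i] .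
  then have "G s + i = G t"
    using t by (rule has_integral_unique)
  then have "i = G t - G s" by simp
  then show ?thesis using i by simp
qed

text \<open>Monotonicity keeps \<open>g\<close> above \<open>g m\<close> to the right of
  \<open>m\<close> and below it to the left; integrating between \<open>m\<close> and
  \<open>t\<close> gives convexity in subgradient form. Monotonicity, linear growth, scaling and
  Jensen's inequality below all come from it.\<close>

lemma young_function_supporting_line:
  assumes "young_function G g" "0 \<le> m" "0 \<le> t"
  shows "G m + g m * (t - m) \<le> G t"
proof (cases "m \<le> t")
  case True
  have "g m * (t - m) \<le> G t - G m"
  proof (rule has_integral_le[of "\<lambda>_. g m" _ "{m..t}" g])
    show "((\<lambda>_. g m) has_integral g m * (t - m)) {m..t}"
      using has_integral_const_real[of "g m" m t] True by (simp add: mult.commute)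
    show "(g has_integral G t - G m) {m..t}"
      using young_function_has_integral assms True by blast
    show "g m \<le> g x" if "x \<in> {m..t}" for x
      using assms that unfolding young_function_def by (auto simp: mono_on_def)
  qed
  then show ?thesis by simp
next
  case False
  have "G m - G t \<le> g m * (m - t)"
  proof (rule has_integral_le[of g _ "{t..m}" "\<lambda>_. g m"])
    show "((\<lambda>_. g m) has_integral g m * (m - t)) {t..m}"
      using has_integral_const_real[of "g m" t m] False by (simp add: mult.commute)
    show "(g has_integral G m - G t) {t..m}"
      using young_function_has_integral assms False by (meson linear)
    show "g x \<le> g m" if "x \<in> {t..m}" for x
      using assms that unfolding young_function_def by (auto simp: mono_on_def)
  qed
  then show ?thesis by (simp add: algebra_simps)
qed

lemma young_function_mono:
  assumes "young_function G g" "0 \<le> s" "s \<le> t" shows "G s \<le> G t"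
proof -
  have "0 \<le> g s * (t - s)"
    using young_function_nonneg_deriv[OF assms(1,2)] assms(3) by simp
  then show ?thesis
    using young_function_supporting_line[of G g s t] assms by linarith
qed

lemma young_function_nonneg:
  assumes "young_function G g" "0 \<le> t" shows "0 \<le> G t"
  using young_function_mono[OF assms(1) order_refl assms(2)] young_function_zero[OF assms(1)]
  by simp

lemma young_function_strict_mono:
  assumes "young_function G g" "0 < s" "s < t" shows "G s < G t"
proof -
  have "0 < g s" using assms unfolding young_function_def by blast
  then have "0 < g s * (t - s)" using assms by simp
  then show ?thesis
    using young_function_supporting_line[of G g s t] assms by linarith
qed

lemma young_function_pos:
  assumes "young_function G g" "0 < t" shows "0 < G t"
  \<comment> \<open>Strict growth is available only from a positive left end, hence
    \<open>t/2\<close> in place of 0.\<close>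
  using young_function_strict_mono[of G g "t/2" t] young_function_nonneg[of G g "t/2"] assms
  by auto

text \<open>The supporting line at 1, read at 0, shows \<open>g 1\<close> \<ge> 1; read at
  \<open>t\<close>, it then gives growth of slope at least 1. This is what lets the Luxemburg norm
  control the L1 norm.\<close>

lemma young_function_ge_id:
  assumes "young_function G g" "G 1 = 1" "0 \<le> t" shows "t \<le> 1 + G t"
proof (cases "t \<le> 1")
  case True
  then show ?thesis using young_function_nonneg[OF assms(1,3)] by simp
next
  case False
  have "1 \<le> g 1"
    using young_function_supporting_line[OF assms(1), of 1 0] young_function_zero[OF assms(1)]
      assms(2) by simp
  then have "1 * (t - 1) \<le> g 1 * (t - 1)"
    using False by (intro mult_right_mono) auto
  then show ?thesis
    using young_function_supporting_line[OF assms(1), of 1 t] assms by simp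
qed

text \<open>A consequence of convexity and \<open>G 0 = 0\<close>: the supporting line at
  \<open>t / d\<close> is read both at 0 and at \<open>t\<close>.\<close>

lemma young_function_scale:
  assumes "young_function G g" "0 \<le> t" "1 \<le> d" shows "G (t / d) \<le> G t / d"
proof -
  define m where "m = t / d"
  have m: "0 \<le> m" "t = d * m" using assms unfolding m_def by auto
  have 1: "G m \<le> g m * m"
    using young_function_supporting_line[OF assms(1) m(1), of 0] young_function_zero[OF assms(1)]
    by simp
  have "G m + g m * (t - m) \<le> G t"
    using young_function_supporting_line[OF assms(1) m(1) assms(2)] .
  moreover have "(d - 1) * G m \<le> (d - 1) * (g m * m)"
    using 1 assms(3) by (intro mult_left_mono) auto
  ultimately have "d * G m \<le> G t"
    using m(2) by (simp add: algebra_simps)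
  then show ?thesis
    using assms(3) unfolding m_def[symmetric] by (simp add: field_simps)
qed

text \<open>Since \<open>x + y\<close> is at most \<open>2 * max x y\<close>, the \<Delta>'
  condition with factor 2 applies. It keeps the energy of \<open>u - \<phi>\<close> finite for
  \<open>u\<close> in the Orlicz space and bounded \<open>\<phi>\<close>.\<close>

lemma Delta'_add_le:
  assumes "young_function G g" "Delta'_condition C G" "0 \<le> x" "0 \<le> y"
  shows "G (x + y) \<le> C * G 2 * (G x + G y)"
proof -
  have C: "1 \<le> C" using assms(2) unfolding Delta'_condition_def by simp
  have "G (x + y) \<le> G (2 * max x y)"
    using assms by (intro young_function_mono[OF assms(1)]) auto
  also have "\<dots> \<le> C * G 2 * G (max x y)"
    using assms unfolding Delta'_condition_def by (simp add: le_max_iff_disj)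
  also have "\<dots> \<le> C * G 2 * (G x + G y)"
    using C assms young_function_nonneg[OF assms(1)]
    by (intro mult_left_mono) (auto simp: max_def)
  finally show ?thesis .
qed

lemma young_function_measurable [measurable (raw)]:
  assumes "young_function G g" "f \<in> borel_measurable M"
  shows "(\<lambda>x. G \<bar>f x :: real\<bar>) \<in> borel_measurable M"
proof -
  \<comment> \<open>\<open>G\<close> is arbitrary at negative arguments; cutting off at 0 gives a
    function monotone on the whole line, hence Borel, which agrees with \<open>G\<close> at absolute
    values.\<close>
  have "mono (\<lambda>x. G (max 0 x))"
    using young_function_mono[OF assms(1)] by (intro monoI) auto
  then have "(\<lambda>x. G (max 0 x)) \<in> borel_measurable borel"
    by (rule borel_measurable_mono)
  then have "(\<lambda>x. (\<lambda>x. G (max 0 x)) \<bar>f x\<bar>) \<in> borel_measurable M"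
    using assms(2) by measurable
  then show ?thesis by simp
qed

text \<open>The supporting line at the mean \<open>m\<close> of \<open>f\<close> is integrated; its
  linear term drops out because \<open>f - m\<close> has integral zero.\<close>

lemma (in finite_measure) young_function_jensen:
  assumes "young_function G g" "integrable M f" "integrable M (\<lambda>x. G (f x))"
    and nonneg: "\<And>x. 0 \<le> f x" and pos: "0 < measure M (space M)"
  shows "measure M (space M) * G ((\<integral>x. f x \<partial>M) / measure M (space M)) \<le> (\<integral>x. G (f x) \<partial>M)"
proof -
  define m where "m = (\<integral>x. f x \<partial>M) / measure M (space M)"
  have m: "0 \<le> m" unfolding m_def using nonneg by (auto intro!: divide_nonneg_nonneg)
  have "(\<integral>x. G m + g m * (f x - m) \<partial>M) \<le> (\<integral>x. G (f x) \<partial>M)"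
    using assms young_function_supporting_line[OF assms(1) m]
    by (intro integral_mono) auto
  moreover have "(\<integral>x. G m + g m * (f x - m) \<partial>M) = measure M (space M) * G m"
    using assms(2) pos by (simp add: m_def)
  ultimately show ?thesis unfolding m_def by simp
qed

section \<open>The Luxemburg norm\<close>

text \<open>Makes the infimum in the Luxemburg norm of \<open>u - \<phi>\<close> a genuine one. The
  energy has an integrable majorant, and a large \<open>\<delta>\<close> scales its integral down to
  1.\<close>

lemma luxemburg_nonempty:
  assumes "young_function G g" "Delta'_condition C G" "\<Omega> \<in> lmeasurable"
    and u: "u \<in> Orlicz G \<Omega>" and bd: "\<And>x. x \<in> \<Omega> \<Longrightarrow> \<bar>\<phi> x\<bar> \<le> B"
  shows "{\<delta>. \<delta> > 0 \<and> (\<integral>\<^sup>+x. ennreal (G (\<bar>u x - \<phi> x\<bar> / \<delta>)) \<partial>lebesgue_on \<Omega>) \<le> 1} \<noteq> {}"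
\<comment> \<open>On an empty \<open>\<Omega>\<close> the bound \<open>bd\<close> is vacuous, so
  \<open>B\<close> could be negative.\<close>
proof (cases "\<Omega> = {}")
  case True
  have "(\<integral>\<^sup>+x. ennreal (G (\<bar>u x - \<phi> x\<bar> / 1)) \<partial>lebesgue_on \<Omega>) = 0"
    unfolding True by (rule nn_integral_empty) simp
  then show ?thesis
    by (intro ex_in_conv[THEN iffD1] exI[of _ 1]) simp
next
  case False
  interpret finite_measure "lebesgue_on \<Omega>"
    using assms(3) by (rule finite_measure_lebesgue_on)
  have C: "1 \<le> C" using assms(2) unfolding Delta'_condition_def by simp
  have B: "0 \<le> B" using bd False by (meson abs_ge_zero all_not_in_conv order_trans)
  define F where "F = (\<lambda>x. C * G 2 * (G \<bar>u x\<bar> + G B))"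
  have F_int: "integrable (lebesgue_on \<Omega>) F"
    using u unfolding F_def Orlicz_def by auto
  have F0: "0 \<le> F x" for x
    unfolding F_def using C B young_function_nonneg[OF assms(1)] by simp
  \<comment> \<open>\<open>d\<close> \<ge> 1 is what \<open>young_function_scale\<close> requires;
    \<open>d\<close> at least the integral of \<open>F\<close> brings the scaled integral below
    1.\<close>
  define d where "d = max 1 (\<integral>x. F x \<partial>lebesgue_on \<Omega>)"
  have d: "1 \<le> d" unfolding d_def by simp
  have le: "G (\<bar>u x - \<phi> x\<bar> / d) \<le> F x / d" if "x \<in> \<Omega>" for x
  proof -
    have "G (\<bar>u x - \<phi> x\<bar> / d) \<le> G \<bar>u x - \<phi> x\<bar> / d"
      using d by (intro young_function_scale[OF assms(1)]) auto
    also have "G \<bar>u x - \<phi> x\<bar> \<le> G (\<bar>u x\<bar> + B)"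
      using bd[OF that] by (intro young_function_mono[OF assms(1)]) auto
    also have "\<dots> \<le> F x"
      unfolding F_def using B by (intro Delta'_add_le[OF assms(1,2)]) auto
    finally show ?thesis using d by (simp add: divide_right_mono)
  qed
  have "(\<integral>\<^sup>+x. ennreal (G (\<bar>u x - \<phi> x\<bar> / d)) \<partial>lebesgue_on \<Omega>)
      \<le> (\<integral>\<^sup>+x. ennreal (F x / d) \<partial>lebesgue_on \<Omega>)"
    by (intro nn_integral_mono ennreal_leI le) simp
  also have "\<dots> = ennreal ((\<integral>x. F x \<partial>lebesgue_on \<Omega>) / d)"
    using F_int F0 d by (subst nn_integral_eq_integral) auto
  also have "\<dots> \<le> 1"
    using d by (simp add: d_def divide_le_eq)
  finally show ?thesis using d by (auto intro!: exI[of _ d])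
qed

text \<open>
  The nonemptiness assumption excludes the unspecified value of \<open>Inf {}\<close>.
\<close>

lemma luxemburg_norm_nonneg:
  assumes "{\<delta>. \<delta> > 0 \<and> (\<integral>\<^sup>+x. ennreal (G (\<bar>f x\<bar> / \<delta>)) \<partial>lebesgue_on \<Omega>) \<le> 1} \<noteq> {}"
  shows "0 \<le> luxemburg_norm G \<Omega> f"
  unfolding luxemburg_norm_def using assms by (intro cInf_greatest) auto

text \<open>Some \<open>d\<close> below \<open>\<epsilon>\<close> is admissible in the infimum.
  Linear growth of \<open>G\<close> at \<open>|f| / d\<close> bounds \<open>|f|\<close> by
  \<open>d * (1 + G (|f| / d))\<close>, whose two terms integrate to the measure of
  \<open>\<Omega>\<close> and to at most 1, up to the factor \<open>d\<close>.\<close>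

lemma luxemburg_norm_less_imp_L1:
  assumes "young_function G g" "G 1 = 1" "\<Omega> \<in> lmeasurable"
    and f [measurable]: "f \<in> borel_measurable (lebesgue_on \<Omega>)"
    and ne: "{\<delta>. \<delta> > 0 \<and> (\<integral>\<^sup>+x. ennreal (G (\<bar>f x\<bar> / \<delta>)) \<partial>lebesgue_on \<Omega>) \<le> 1} \<noteq> {}"
    and less: "luxemburg_norm G \<Omega> f < \<epsilon>"
  shows "integrable (lebesgue_on \<Omega>) f"
    and "(LINT x|lebesgue_on \<Omega>. \<bar>f x\<bar>) \<le> \<epsilon> * (measure lebesgue \<Omega> + 1)"
proof -
  interpret finite_measure "lebesgue_on \<Omega>"
    using assms(3) by (rule finite_measure_lebesgue_on)
  let ?L = "measure lebesgue \<Omega>"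
  obtain d where d: "0 < d" "d < \<epsilon>"
    and le1: "(\<integral>\<^sup>+x. ennreal (G (\<bar>f x\<bar> / d)) \<partial>lebesgue_on \<Omega>) \<le> 1"
    using cInf_lessD[OF ne less[unfolded luxemburg_norm_def]] by blast
  have [measurable]: "(\<lambda>x. G (\<bar>f x\<bar> / d)) \<in> borel_measurable (lebesgue_on \<Omega>)"
    using young_function_measurable[OF assms(1), of "\<lambda>x. f x / d" "lebesgue_on \<Omega>"] d by simp
  \<comment> \<open>A nonnegative integral is estimated, so that integrability and the bound follow
    together.\<close>
  have "(\<integral>\<^sup>+x. ennreal \<bar>f x\<bar> \<partial>lebesgue_on \<Omega>)
      \<le> (\<integral>\<^sup>+x. ennreal d * (1 + ennreal (G (\<bar>f x\<bar> / d))) \<partial>lebesgue_on \<Omega>)"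
  proof (intro nn_integral_mono)
    fix x
    have "\<bar>f x\<bar> / d \<le> 1 + G (\<bar>f x\<bar> / d)"
      using d by (intro young_function_ge_id[OF assms(1,2)]) auto
    then have "\<bar>f x\<bar> \<le> d * (1 + G (\<bar>f x\<bar> / d))"
      using d by (simp add: field_simps)
    moreover have "0 \<le> G (\<bar>f x\<bar> / d)" using young_function_nonneg[OF assms(1)] d by simp
    ultimately show "ennreal \<bar>f x\<bar> \<le> ennreal d * (1 + ennreal (G (\<bar>f x\<bar> / d)))"
      using d by (simp add: ennreal_mult ennreal_leI flip: ennreal_1 ennreal_plus ennreal_mult)
  qed
  also have "\<dots> = ennreal d * (emeasure lebesgue \<Omega> + (\<integral>\<^sup>+x. ennreal (G (\<bar>f x\<bar> / d)) \<partial>lebesgue_on \<Omega>))"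
    using assms(3) by (simp add: nn_integral_cmult nn_integral_add emeasure_restrict_space fmeasurableD)
  also have "\<dots> \<le> ennreal d * (ennreal ?L + 1)"
    using assms(3) le1 by (intro mult_left_mono add_mono) (auto simp: emeasure_eq_measure2)
  also have "\<dots> = ennreal (d * (?L + 1))"
    using d by (simp add: ennreal_mult flip: ennreal_1 ennreal_plus)
  finally have nn: "(\<integral>\<^sup>+x. ennreal \<bar>f x\<bar> \<partial>lebesgue_on \<Omega>) \<le> ennreal (d * (?L + 1))" .
  show "integrable (lebesgue_on \<Omega>) f"
    using nn by (intro integrableI_bounded) (auto intro: le_less_trans)
  have "(LINT x|lebesgue_on \<Omega>. \<bar>f x\<bar>) \<le> d * (?L + 1)"
    using nn d by (subst integral_eq_nn_integral) (auto intro!: enn2real_leI)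
  also have "\<dots> \<le> \<epsilon> * (?L + 1)"
    using d by (intro mult_right_mono) auto
  finally show "(LINT x|lebesgue_on \<Omega>. \<bar>f x\<bar>) \<le> \<epsilon> * (?L + 1)" .
qed

section \<open>The pointwise bound on an interval\<close>

lemma test_function_continuous:
  assumes "\<phi> \<in> test_functions \<Omega>"
  shows "continuous_on A \<phi>" "continuous_on A (deriv \<phi>)"
proof -
  have d: "(deriv ^^ n) \<phi> differentiable (at x)" for n x
    using assms unfolding test_functions_def by blast
  show "continuous_on A \<phi>"
    using d[of 0] by (auto intro!: continuous_at_imp_continuous_on differentiable_imp_continuous_within)
  show "continuous_on A (deriv \<phi>)"
    using d[of 1] by (auto intro!: continuous_at_imp_continuous_on differentiable_imp_continuous_within)
qed

lemma continuous_on_interval_bounded: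
  fixes f :: "real \<Rightarrow> real"
  assumes "continuous_on {a..b} f"
  obtains B where "\<And>x. x \<in> {a<..<b} \<Longrightarrow> \<bar>f x\<bar> \<le> B"
proof -
  have "bounded (f ` {a..b})"
    using assms by (intro compact_imp_bounded compact_continuous_image) auto
  then show ?thesis
    using that unfolding bounded_iff by fastforce
qed

text \<open>As \<open>\<phi>\<close> vanishes at both endpoints, \<open>|\<phi> x|\<close> is
  bounded by the integral of \<open>|deriv \<phi>|\<close> to the left of \<open>x\<close> and also
  by that to the right; the sum of both bounds gives the factor 2.\<close>

lemma test_function_bound:
  assumes \<phi>: "\<phi> \<in> test_functions {a<..<b}" and x: "x \<in> {a<..<b}"
  shows "2 * \<bar>\<phi> x\<bar> \<le> (LINT y|lebesgue_on {a<..<b}. \<bar>deriv \<phi> y\<bar>)"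
proof -
  \<comment> \<open>The endpoints lie outside the open interval, hence outside the compact set
    carrying \<open>\<phi>\<close>.\<close>
  have ends: "\<phi> a = 0" "\<phi> b = 0"
    using \<phi> unfolding test_functions_def by auto
  have diff: "(\<phi> has_vector_derivative deriv \<phi> y) (at y within A)" for y A
  proof -
    have "(deriv ^^ 0) \<phi> differentiable (at y)"
      using \<phi> unfolding test_functions_def by blast
    then have "(\<phi> has_real_derivative deriv \<phi> y) (at y)"
      by (simp add: DERIV_deriv_iff_real_differentiable)
    then show ?thesis
      by (simp add: has_real_derivative_iff_has_vector_derivative has_vector_derivative_at_within)
  qed
  have int: "(\<lambda>y. \<bar>deriv \<phi> y\<bar>) integrable_on {s..t}" for s t
    by (intro integrable_continuous_real continuous_intros test_function_continuous[OF \<phi>])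
  have step: "\<bar>\<phi> t - \<phi> s\<bar> \<le> integral {s..t} (\<lambda>y. \<bar>deriv \<phi> y\<bar>)" if "s \<le> t" for s t
  proof -
    have h: "(deriv \<phi> has_integral \<phi> t - \<phi> s) {s..t}"
      using that diff by (intro fundamental_theorem_of_calculus) auto
    then have "\<bar>integral {s..t} (deriv \<phi>)\<bar> \<le> integral {s..t} (\<lambda>y. \<bar>deriv \<phi> y\<bar>)"
      using integral_norm_bound_integral[of "deriv \<phi>" "{s..t}" "\<lambda>y. \<bar>deriv \<phi> y\<bar>"] int
      by auto
    then show ?thesis using h by (simp add: integral_unique)
  qed
  \<comment> \<open>Needed to identify the Henstock-Kurzweil integral, in which the fundamental
    theorem of calculus is applied, with the Lebesgue integral.\<close>
  have "deriv \<phi> absolutely_integrable_on {a<..<b}"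
  proof -
    have "deriv \<phi> absolutely_integrable_on {a..b}"
      by (intro absolutely_integrable_continuous_real test_function_continuous[OF \<phi>])
    then show ?thesis
      by (rule set_integrable_subset) auto
  qed
  then have \<phi>'_int: "integrable (lebesgue_on {a<..<b}) (deriv \<phi>)"
    by (simp add: absolutely_integrable_imp_integrable)
  have "2 * \<bar>\<phi> x\<bar> \<le> integral {a..x} (\<lambda>y. \<bar>deriv \<phi> y\<bar>) + integral {x..b} (\<lambda>y. \<bar>deriv \<phi> y\<bar>)"
    using step[of a x] step[of x b] x ends by simp
  also have "\<dots> = integral {a..b} (\<lambda>y. \<bar>deriv \<phi> y\<bar>)"
    using x int by (intro Henstock_Kurzweil_Integration.integral_combine) auto
  also have "\<dots> = integral {a<..<b} (\<lambda>y. \<bar>deriv \<phi> y\<bar>)"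
    by (simp add: integral_open_interval_real)
  also have "\<dots> = (LINT y|lebesgue_on {a<..<b}. \<bar>deriv \<phi> y\<bar>)"
    using \<phi>'_int by (intro lebesgue_integral_eq_integral[symmetric]) auto
  finally show "2 * \<bar>\<phi> x\<bar> \<le> (LINT y|lebesgue_on {a<..<b}. \<bar>deriv \<phi> y\<bar>)" .
qed

text \<open>To pass to the limit without an a.e. convergent subsequence, the positive part of
  \<open>2 * |u| - I\<close> is shown to have integral below every positive number; hence it
  vanishes a.e.\<close>

lemma W1_0_pointwise_bound:
  assumes "a < b" "young_function G g" "G 1 = 1" "Delta'_condition C G"
    and u: "u \<in> W1_0 G {a<..<b}"
  defines "v \<equiv> weak_deriv {a<..<b} u"
  shows "integrable (lebesgue_on {a<..<b}) v"
    and "AE x in lebesgue_on {a<..<b}. 2 * \<bar>u x\<bar> \<le> (LINT y|lebesgue_on {a<..<b}. \<bar>v y\<bar>)"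
proof -
  let ?\<Omega> = "{a<..<b}"
  let ?M = "lebesgue_on ?\<Omega>"
  have \<Omega>: "?\<Omega> \<in> lmeasurable" by simp
  interpret finite_measure ?M using \<Omega> by (rule finite_measure_lebesgue_on)
  have uO: "u \<in> Orlicz G ?\<Omega>" and vO: "v \<in> Orlicz G ?\<Omega>"
    using u unfolding W1_0_def W1_def v_def by auto
  have [measurable]: "u \<in> borel_measurable ?M" "v \<in> borel_measurable ?M"
    using uO vO unfolding Orlicz_def by auto
  define L where "L = b - a"
  have L: "0 < L" "measure lebesgue ?\<Omega> = L" "measure ?M ?\<Omega> = L"
    using assms(1) by (auto simp: L_def measure_restrict_space)
  define I where "I = (LINT y|?M. \<bar>v y\<bar>)"
  \<comment> \<open>The constant is \<open>(L + 1) * L + 2 * (L + 1)\<close>: an error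
    \<open>\<epsilon> * (L + 1)\<close> from the derivatives integrated over length
    \<open>L\<close>, plus twice the L1 distance of \<open>u\<close> and
    \<open>\<phi>\<close>.\<close>
  have approx: "integrable ?M u \<and> integrable ?M v \<and>
      (LINT x|?M. max 0 (2 * \<bar>u x\<bar> - I)) \<le> \<epsilon> * ((L + 1) * (L + 2))" if \<epsilon>: "0 < \<epsilon>" for \<epsilon>
  proof -
    obtain \<phi> where \<phi>: "\<phi> \<in> test_functions ?\<Omega>"
      and less: "luxemburg_norm G ?\<Omega> (\<lambda>x. u x - \<phi> x) +
                 luxemburg_norm G ?\<Omega> (\<lambda>x. v x - deriv \<phi> x) < \<epsilon>"
      using u \<epsilon> unfolding W1_0_def v_def by blast
    note cont = test_function_continuous[OF \<phi>]
    have [measurable]: "\<phi> \<in> borel_measurable ?M" "deriv \<phi> \<in> borel_measurable ?M"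
      using cont by (auto intro!: continuous_imp_measurable_on_sets_lebesgue)
    obtain B1 where B1: "\<And>x. x \<in> ?\<Omega> \<Longrightarrow> \<bar>\<phi> x\<bar> \<le> B1"
      using continuous_on_interval_bounded cont(1) by blast
    obtain B2 where B2: "\<And>x. x \<in> ?\<Omega> \<Longrightarrow> \<bar>deriv \<phi> x\<bar> \<le> B2"
      using continuous_on_interval_bounded cont(2) by blast
    note ne1 = luxemburg_nonempty[where \<phi> = \<phi>, OF assms(2,4) \<Omega> uO B1]
    note ne2 = luxemburg_nonempty[where \<phi> = "deriv \<phi>", OF assms(2,4) \<Omega> vO B2]
    \<comment> \<open>Splitting the sum requires both norms to be nonnegative, which
      \<open>ne1\<close> and \<open>ne2\<close> secure.\<close>
    have less1: "luxemburg_norm G ?\<Omega> (\<lambda>x. u x - \<phi> x) < \<epsilon>"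
      and less2: "luxemburg_norm G ?\<Omega> (\<lambda>x. v x - deriv \<phi> x) < \<epsilon>"
      using less luxemburg_norm_nonneg[OF ne1] luxemburg_norm_nonneg[OF ne2] by auto
    have i1: "integrable ?M (\<lambda>x. u x - \<phi> x)"
      and e1: "(LINT x|?M. \<bar>u x - \<phi> x\<bar>) \<le> \<epsilon> * (L + 1)"
      using luxemburg_norm_less_imp_L1[OF assms(2,3) \<Omega> _ ne1 less1] L by auto
    have i2: "integrable ?M (\<lambda>x. v x - deriv \<phi> x)"
      and e2: "(LINT x|?M. \<bar>v x - deriv \<phi> x\<bar>) \<le> \<epsilon> * (L + 1)"
      using luxemburg_norm_less_imp_L1[OF assms(2,3) \<Omega> _ ne2 less2] L by auto
    have i\<phi>: "integrable ?M \<phi>"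
      by (rule integrable_const_bound[of _ B1]) (use B1 in \<open>auto intro: AE_I2\<close>)
    have i\<phi>': "integrable ?M (deriv \<phi>)"
      by (rule integrable_const_bound[of _ B2]) (use B2 in \<open>auto intro: AE_I2\<close>)
    have iu: "integrable ?M u" and iv: "integrable ?M v"
      using Bochner_Integration.integrable_add[OF i1 i\<phi>]
        Bochner_Integration.integrable_add[OF i2 i\<phi>'] by auto
    \<comment> \<open>L1 closeness of the derivatives turns the bound for \<open>\<phi>\<close> into
      one by \<open>I\<close> with a small error.\<close>
    have "(LINT x|?M. \<bar>deriv \<phi> x\<bar>) \<le> (LINT x|?M. \<bar>v x\<bar> + \<bar>v x - deriv \<phi> x\<bar>)"
      using i2 i\<phi>' iv by (intro integral_mono) auto
    also have "\<dots> \<le> I + \<epsilon> * (L + 1)"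
      using i2 iv e2 by (simp add: I_def)
    finally have \<phi>I: "2 * \<bar>\<phi> x\<bar> \<le> I + \<epsilon> * (L + 1)" if "x \<in> ?\<Omega>" for x
      using test_function_bound[OF \<phi> that] by simp
    have "(LINT x|?M. max 0 (2 * \<bar>u x\<bar> - I)) \<le> (LINT x|?M. \<epsilon> * (L + 1) + 2 * \<bar>u x - \<phi> x\<bar>)"
    proof (rule integral_mono)
      show "max 0 (2 * \<bar>u x\<bar> - I) \<le> \<epsilon> * (L + 1) + 2 * \<bar>u x - \<phi> x\<bar>" if "x \<in> space ?M" for x
      proof -
        have "0 \<le> \<epsilon> * (L + 1)" using \<epsilon> L(1) by simp
        moreover have "\<bar>u x\<bar> \<le> \<bar>\<phi> x\<bar> + \<bar>u x - \<phi> x\<bar>" by simp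
        moreover have "2 * \<bar>\<phi> x\<bar> \<le> I + \<epsilon> * (L + 1)" using \<phi>I that by simp
        ultimately show ?thesis by (smt (verit))
      qed
    qed (use iu i1 in auto)
    also have "\<dots> = \<epsilon> * (L + 1) * L + 2 * (LINT x|?M. \<bar>u x - \<phi> x\<bar>)"
      using i1 L by simp
    also have "\<dots> \<le> \<epsilon> * ((L + 1) * (L + 2))"
      using e1 by (simp add: algebra_simps)
    finally show ?thesis using iu iv by simp
  qed
  show "integrable ?M v" using approx[of 1] by simp
  have iu: "integrable ?M u" using approx[of 1] by simp
  have "(LINT x|?M. max 0 (2 * \<bar>u x\<bar> - I)) \<le> 0 + e" if "0 < e" for e
    using approx[of "e / ((L + 1) * (L + 2))"] that L(1) by auto
  then have "(LINT x|?M. max 0 (2 * \<bar>u x\<bar> - I)) \<le> 0"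
    by (rule field_le_epsilon)
  moreover have "0 \<le> (LINT x|?M. max 0 (2 * \<bar>u x\<bar> - I))"
    by (intro Bochner_Integration.integral_nonneg) auto
  ultimately have "AE x in ?M. max 0 (2 * \<bar>u x\<bar> - I) = 0"
    using iu by (subst integral_nonneg_eq_0_iff_AE[symmetric]) auto
  then show "AE x in ?M. 2 * \<bar>u x\<bar> \<le> (LINT y|?M. \<bar>v y\<bar>)"
    unfolding I_def[symmetric] by eventually_elim (simp add: max_def split: if_splits)
qed

section \<open>The lower bound for the eigenvalue\<close>

theorem theorem5p2:
  fixes a b C k p1 p2 :: real
    and G g H h w :: "real \<Rightarrow> real"
  assumes "a < b"
    and "1 \<le> p1" and "p1 \<le> p2"
    and "standard_young_function p1 p2 G g"
    and "standard_young_function p1 p2 H h"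
    and "Delta'_condition C G"
    and "Delta'_condition C H"
    and "w \<in> L_infty {a<..<b}"
    and "AE x in lebesgue_on {a<..<b}. 0 \<le> w x"
    and "\<not> (AE x in lebesgue_on {a<..<b}. w x = 0)"
    and "dominated_with k H G"
  shows "\<forall>\<mu>>0. ereal ((b - a) / (C * k * (LINT x|lebesgue_on {a<..<b}. \<bar>w x\<bar>) * G (k * (b - a) / 2)))
                 \<le> first_eigenvalue G H w {a<..<b} \<mu>"
proof (intro allI impI)
  fix \<mu> :: real assume \<mu>: "0 < \<mu>"
  let ?M = "lebesgue_on {a<..<b}"
  interpret finite_measure ?M by (rule finite_measure_lebesgue_on) simp
  have YG: "young_function G g" "G 1 = 1" and YH: "young_function H h" "H 1 = 1"
    using assms(4,5) unfolding standard_young_function_def by auto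
  have C: "1 \<le> C" and D: "\<And>x y. 0 \<le> x \<Longrightarrow> 0 \<le> y \<Longrightarrow> G (x * y) \<le> C * G x * G y"
    using assms(6) unfolding Delta'_condition_def by auto
  have k0: "0 < k" and dom: "\<And>t. 0 \<le> t \<Longrightarrow> H t \<le> G (k * t)"
    using assms(11) unfolding dominated_with_def by auto
  have k: "1 \<le> k"
  proof (rule ccontr)
    assume "\<not> 1 \<le> k"
    then have "G k < G 1" using k0 by (intro young_function_strict_mono[OF YG(1)]) auto
    then show False using dom[of 1] YG YH by simp
  qed
  define L where "L = b - a"
  have L: "0 < L" "measure ?M {a<..<b} = L"
    using assms(1) by (auto simp: L_def measure_restrict_space)
  define W where "W = (LINT x|?M. \<bar>w x\<bar>)"
  define E where "E = G (k * L / 2)"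
  have E: "0 < E" unfolding E_def using k0 L by (intro young_function_pos[OF YG(1)]) auto
  have w_int: "integrable ?M w"
  proof -
    obtain B where "AE x in ?M. \<bar>w x\<bar> \<le> B" and "w \<in> borel_measurable ?M"
      using assms(8) unfolding L_infty_def by blast
    then show ?thesis by (intro integrable_const_bound[of _ B]) auto
  qed
  have "ereal (L / (C * k * W * E)) \<le> first_eigenvalue G H w {a<..<b} \<mu>"
    unfolding first_eigenvalue_def
  \<comment> \<open>A bound on each quotient suffices; with no admissible \<open>u\<close> the
    infimum is \<infinity>.\<close>
  proof (rule INF_greatest)
    fix u assume "u \<in> admissible G H w {a<..<b} \<mu>"
    then have u: "u \<in> W1_0 G {a<..<b}"
      and int: "integrable ?M (\<lambda>x. w x * H \<bar>u x\<bar>)" and eq: "(LINT x|?M. w x * H \<bar>u x\<bar>) = \<mu>"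
      unfolding admissible_def by auto
    define v where "v = weak_deriv {a<..<b} u"
    define N where "N = (LINT x|?M. G \<bar>v x\<bar>)"
    define I where "I = (LINT x|?M. \<bar>v x\<bar>)"
    have vG: "integrable ?M (\<lambda>x. G \<bar>v x\<bar>)"
      using u unfolding W1_0_def W1_def Orlicz_def v_def by auto
    note bound = W1_0_pointwise_bound[OF assms(1) YG assms(6) u, folded v_def, folded I_def]
    have I0: "0 \<le> I" unfolding I_def by simp
    have N0: "0 \<le> N" unfolding N_def using young_function_nonneg[OF YG(1)]
      by (intro Bochner_Integration.integral_nonneg) auto
    have "L * G (I / L) \<le> N"
      using young_function_jensen[OF YG(1), of "\<lambda>x. \<bar>v x\<bar>"] bound(1) vG L
      by (simp add: I_def N_def)
    then have jensen: "G (I / L) \<le> N / L" using L(1) by (simp add: field_simps)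
    \<comment> \<open>The argument is factored so that one factor yields \<open>E\<close> and the
      other is the mean of \<open>|v|\<close>, ready for Jensen's inequality.\<close>
    have "G (k * I / 2) = G ((k * L / 2) * (I / L))" using L(1) by simp
    also have "\<dots> \<le> C * E * G (I / L)"
      unfolding E_def using k0 L I0 by (intro D) auto
    also have "\<dots> \<le> C * E * (N / L)"
      using jensen C E by (intro mult_left_mono) auto
    finally have GI: "G (k * I / 2) \<le> C * E * (N / L)" .
    have "\<mu> \<le> (LINT x|?M. \<bar>w x\<bar> * (C * E * (N / L)))"
      unfolding eq[symmetric]
    proof (rule integral_mono_AE)
      show "AE x in ?M. w x * H \<bar>u x\<bar> \<le> \<bar>w x\<bar> * (C * E * (N / L))"
        using bound(2) assms(9)
      proof eventually_elim
        case (elim x)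
        have "H \<bar>u x\<bar> \<le> G (k * \<bar>u x\<bar>)" by (rule dom) simp
        also have "\<dots> \<le> G (k * I / 2)"
          using elim k0 by (intro young_function_mono[OF YG(1)]) (auto simp: field_simps)
        finally have "H \<bar>u x\<bar> \<le> C * E * (N / L)" using GI by simp
        then show ?case using elim by (simp only: abs_of_nonneg mult_left_mono)
      qed
    qed (use int w_int in auto)
    also have "\<dots> = W * (C * E * (N / L))" by (simp add: W_def)
    finally have \<mu>_le: "\<mu> \<le> W * C * E * N / L" by (simp add: mult_ac)
    have W0: "0 \<le> W" unfolding W_def by simp
    \<comment> \<open>With \<open>W = 0\<close> the bound just obtained would force
      \<open>\<mu>\<close> \<le> 0.\<close>
    have W: "0 < W" using W0 \<mu>_le \<mu> by (cases "W = 0") auto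
    \<comment> \<open>The factor 1 is a placeholder to be enlarged to \<open>k\<close>; rearranging
      then isolates the quotient \<open>N / \<mu>\<close>.\<close>
    have "L * \<mu> \<le> 1 * (W * C * E * N)" using \<mu>_le L(1) by (simp add: field_simps)
    also have "\<dots> \<le> k * (W * C * E * N)"
      using k W C E N0 by (intro mult_right_mono) auto
    finally have "L / (C * k * W * E) \<le> N / \<mu>"
      using \<mu> W C E k0 by (simp add: field_simps)
    then show "ereal (L / (C * k * W * E))
        \<le> ereal ((LINT x|?M. G \<bar>weak_deriv {a<..<b} u x\<bar>) / (LINT x|?M. w x * H \<bar>u x\<bar>))"
      by (simp add: eq N_def v_def)
  qed
  then show "ereal ((b - a) / (C * k * (LINT x|?M. \<bar>w x\<bar>) * G (k * (b - a) / 2)))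
      \<le> first_eigenvalue G H w {a<..<b} \<mu>"
    by (simp add: L_def W_def E_def)
qed

end
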